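(* Let $G$ be a group with neutral element $e$ and let $S$ be a nonzero nearly epsilon-strongly $G$-graded ring. Then the map $I\mapsto I_e:=I\cap S_e$ is a bijection from the set of graded ideals of $S$ to the set of $G$-invariant ideals of $S_e$. The inverse map is given by $J\mapsto SJS$.
   Context: Rings are associative but not necessarily unital; ideals are two-sided. For subsets $U,V$ of a ring, $UV$ denotes the set of finite sums of elements $uv$ with $u\in U$, $v\in V$. A ring $S$ is $G$-graded if $S=\bigoplus_{x\in G}S_x$ as additive groups for given additive subgroups $S_x$, with $S_xS_y\subseteq S_{xy}$ for all $x,y\in G$. $S$ is nearly epsilon-strongly $G$-graded if for every $x\in G$ and every $s\in S_x$ there exist $\epsilon_x(s)\in S_xS_{x^{-1}}$ and $\epsilon_x'(s)\in S_{x^{-1}}S_x$ such that $\epsilon_x(s)s=s=s\epsilon_x'(s)$. An ideal $I$ of $S$ is graded if $I=\bigoplus_{x\in G}(I\cap S_x)$. An ideal $J$ of $S_e$ is $G$-invariant if $S_{x^{-1}}JS_x\subseteq J$ for every $x\in G$. *)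

theory Defs
  imports Main "HOL-Algebra.Group"
begin

text \<open>
  The type class \<^class>\<open>ring\<close> describes associative rings that need not have a unit; the ring
  graded by the group is taken to be a whole type of this class, and subrings and ideals are
  subsets of that type.
\<close>

definition add_subgroup :: "'a::ab_group_add set \<Rightarrow> bool" where
  "add_subgroup A \<longleftrightarrow> 0 \<in> A \<and> (\<forall>a\<in>A. \<forall>b\<in>A. a + b \<in> A) \<and> (\<forall>a\<in>A. - a \<in> A)"

definition set_prod :: "'a::ring set \<Rightarrow> 'a set \<Rightarrow> 'a set" (infixl \<open>\<odot>\<close> 70) where
  "U \<odot> V = {\<Sum>i<n. u i * v i | (n::nat) u v. \<forall>i<n. u i \<in> U \<and> v i \<in> V}"

text \<open>
  The external direct sum of the \<open>N i\<close> with \<open>i \<in> I\<close>, realised as families of finite support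
  that vanish outside \<open>I\<close>.
\<close>

definition direct_sum_families :: "'i set \<Rightarrow> ('i \<Rightarrow> 'a::ab_group_add set) \<Rightarrow> ('i \<Rightarrow> 'a) set" where
  "direct_sum_families I N =
     {f. (\<forall>i\<in>I. f i \<in> N i) \<and> (\<forall>i. i \<notin> I \<longrightarrow> f i = 0) \<and> finite {i. f i \<noteq> 0}}"

text \<open>\<open>M = \<Oplus>\<^sub>i N i\<close>: every element of \<open>M\<close> is such a sum in a unique way, and all these sums
  lie in \<open>M\<close>.\<close>

definition is_direct_sum :: "'i set \<Rightarrow> ('i \<Rightarrow> 'a::ab_group_add set) \<Rightarrow> 'a set \<Rightarrow> bool" where
  "is_direct_sum I N M \<longleftrightarrow>
     (\<forall>i\<in>I. add_subgroup (N i)) \<and>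
     bij_betw (\<lambda>f. \<Sum>i | f i \<noteq> 0. f i) (direct_sum_families I N) M"

definition graded_ring :: "('g, 'm) monoid_scheme \<Rightarrow> ('g \<Rightarrow> 'a::ring set) \<Rightarrow> bool" where
  "graded_ring G S \<longleftrightarrow>
     is_direct_sum (carrier G) S UNIV \<and>
     (\<forall>x\<in>carrier G. \<forall>y\<in>carrier G. S x \<odot> S y \<subseteq> S (x \<otimes>\<^bsub>G\<^esub> y))"

definition nearly_epsilon_strongly_graded ::
    "('g, 'm) monoid_scheme \<Rightarrow> ('g \<Rightarrow> 'a::ring set) \<Rightarrow> bool" where
  "nearly_epsilon_strongly_graded G S \<longleftrightarrow>
     graded_ring G S \<and>
     (\<forall>x\<in>carrier G. \<forall>s\<in>S x.
        \<exists>\<epsilon> \<in> S x \<odot> S (inv\<^bsub>G\<^esub> x). \<exists>\<epsilon>' \<in> S (inv\<^bsub>G\<^esub> x) \<odot> S x. \<epsilon> * s = s \<and> s = s * \<epsilon>')"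

definition ideal_of :: "'a::ring set \<Rightarrow> 'a set \<Rightarrow> bool" where
  "ideal_of R J \<longleftrightarrow>
     J \<subseteq> R \<and> add_subgroup J \<and> (\<forall>r\<in>R. \<forall>j\<in>J. r * j \<in> J \<and> j * r \<in> J)"

definition graded_ideal :: "('g, 'm) monoid_scheme \<Rightarrow> ('g \<Rightarrow> 'a::ring set) \<Rightarrow> 'a set \<Rightarrow> bool" where
  "graded_ideal G S I \<longleftrightarrow>
     ideal_of UNIV I \<and> is_direct_sum (carrier G) (\<lambda>x. I \<inter> S x) I"

definition invariant_ideal ::
    "('g, 'm) monoid_scheme \<Rightarrow> ('g \<Rightarrow> 'a::ring set) \<Rightarrow> 'a set \<Rightarrow> bool" where
  "invariant_ideal G S J \<longleftrightarrow>
     ideal_of (S \<one>\<^bsub>G\<^esub>) J \<and> (\<forall>x\<in>carrier G. S (inv\<^bsub>G\<^esub> x) \<odot> J \<odot> S x \<subseteq> J)"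

end

theory Submission
  imports Defs
begin

text \<open>
  The heart of the matter is that homogeneous components of \<open>SJS\<close> are under control: \<open>SJS\<close> is
  spanned by the products \<open>r j s\<close> with \<open>r \<in> S\<^sub>x\<close>, \<open>s \<in> S\<^sub>y\<close>, each of which is homogeneous of degree
  \<open>x y\<close>. If \<open>x y = e\<close> then \<open>r j s \<in> J\<close> by invariance, so the \<open>e\<close>-component of \<open>SJS\<close> is contained
  in \<open>J\<close>; local units give the reverse inclusion. For a graded ideal \<open>I\<close> and \<open>a \<in> I \<inter> S\<^sub>x\<close>,
  writing \<open>a = (\<Sum>i. u\<^sub>i v\<^sub>i) a \<epsilon>'\<close> with \<open>v\<^sub>i \<in> S\<^bsub>x\<inverse>\<^esub>\<close> shows \<open>a \<in> S I\<^sub>e S\<close>, because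
  \<open>v\<^sub>i a \<in> I\<^sub>e\<close>.
\<close>

section \<open>Additive subgroups and products of subsets\<close>

lemma add_subgroup_zero: "add_subgroup A \<Longrightarrow> 0 \<in> A"
  and add_subgroup_add: "add_subgroup A \<Longrightarrow> a \<in> A \<Longrightarrow> b \<in> A \<Longrightarrow> a + b \<in> A"
  and add_subgroup_uminus: "add_subgroup A \<Longrightarrow> a \<in> A \<Longrightarrow> - a \<in> A"
  by (auto simp: add_subgroup_def)

lemma add_subgroup_sum:
  assumes "add_subgroup A" "\<And>i. i \<in> F \<Longrightarrow> f i \<in> A"
  shows "sum f F \<in> A"
  using assms(2)
  by (induction F rule: infinite_finite_induct)
     (auto intro: add_subgroup_zero add_subgroup_add assms(1))

lemma add_subgroup_UNIV: "add_subgroup UNIV"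
  by (simp add: add_subgroup_def)

lemma add_subgroup_Int: "add_subgroup A \<Longrightarrow> add_subgroup B \<Longrightarrow> add_subgroup (A \<inter> B)"
  by (simp add: add_subgroup_def)

text \<open>A property that holds at 0, is additive and holds for single products passes to all
  finite sums of products; later proofs thus avoid indexed sums.\<close>

lemma set_prod_induct [consumes 1, case_names zero add mult]:
  assumes "a \<in> U \<odot> V"
    and "P 0"
    and "\<And>a b. P a \<Longrightarrow> P b \<Longrightarrow> P (a + b)"
    and "\<And>u v. u \<in> U \<Longrightarrow> v \<in> V \<Longrightarrow> P (u * v)"
  shows "P a"
proof -
  obtain n :: nat and u v where a: "a = (\<Sum>i<n. u i * v i)" and uv: "\<forall>i<n. u i \<in> U \<and> v i \<in> V"
    using assms(1) unfolding set_prod_def by blast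
  \<comment> \<open>The bound on \<open>k\<close> keeps every index in the range where the factors
    lie in \<open>U\<close> and \<open>V\<close>.\<close>
  have "P (\<Sum>i<k. u i * v i)" if "k \<le> n" for k
    using that by (induction k) (use uv in \<open>auto intro!: assms(2-4)\<close>)
  then show ?thesis
    using a by simp
qed

lemma set_prod_mult: "u \<in> U \<Longrightarrow> v \<in> V \<Longrightarrow> u * v \<in> U \<odot> V"
  unfolding set_prod_def
  by (rule CollectI, rule exI[of _ 1], rule exI[of _ "\<lambda>_. u"], rule exI[of _ "\<lambda>_. v"]) simp

lemma set_prod_zero: "0 \<in> U \<odot> V"
  unfolding set_prod_def by (auto intro!: exI[of _ 0])

lemma set_prod_add:
  assumes "a \<in> U \<odot> V" "b \<in> U \<odot> V"
  shows "a + b \<in> U \<odot> V"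
proof -
  obtain n :: nat and u v where a: "a = (\<Sum>i<n. u i * v i)" and uv: "\<forall>i<n. u i \<in> U \<and> v i \<in> V"
    using assms(1) unfolding set_prod_def by blast
  obtain m :: nat and u' v' where b: "b = (\<Sum>i<m. u' i * v' i)"
    and uv': "\<forall>i<m. u' i \<in> U \<and> v' i \<in> V"
    using assms(2) unfolding set_prod_def by blast
  \<comment> \<open>The two families of factors are concatenated, the second one shifted by
    \<open>n\<close>.\<close>
  define p where "p i = (if i < n then u i else u' (i - n))" for i
  define q where "q i = (if i < n then v i else v' (i - n))" for i
  have "(\<Sum>i<n + k. p i * q i) = a + (\<Sum>i<k. u' i * v' i)" for k
    by (induction k) (simp_all add: a p_def q_def)
  then have "a + b = (\<Sum>i<n + m. p i * q i)"
    by (simp add: b)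
  moreover have "\<forall>i<n + m. p i \<in> U \<and> q i \<in> V"
    using uv uv' by (simp add: p_def q_def)
  ultimately show ?thesis
    unfolding set_prod_def by blast
qed

lemma set_prod_subset:
  assumes "add_subgroup W" "\<And>u v. u \<in> U \<Longrightarrow> v \<in> V \<Longrightarrow> u * v \<in> W"
  shows "U \<odot> V \<subseteq> W"
proof
  fix a assume "a \<in> U \<odot> V"
  then show "a \<in> W"
    by (induction rule: set_prod_induct) (use assms in \<open>auto simp: add_subgroup_def\<close>)
qed

text \<open>Negation moves onto the right factor: -(u v) = u (-v).\<close>

lemma add_subgroup_set_prod:
  assumes "add_subgroup V"
  shows "add_subgroup (U \<odot> V)"
proof -
  have "- a \<in> U \<odot> V" if "a \<in> U \<odot> V" for a
    using that
  proof (induction rule: set_prod_induct)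
    case (add a b)
    then show ?case
      using set_prod_add[of "- a" U V "- b"] by simp
  next
    case (mult u v)
    then show ?case
      using set_prod_mult[of u U "- v" V] add_subgroup_uminus[OF assms] by simp
  qed (simp add: set_prod_zero)
  then show ?thesis
    by (simp add: add_subgroup_def set_prod_zero set_prod_add)
qed

text \<open>The outer factors absorb multiplication: r (u v) = (r u) v and (u v) r = u (v
  r).\<close>

lemma ideal_of_UNIV_set_prod: "ideal_of UNIV (UNIV \<odot> J \<odot> UNIV)"
proof -
  let ?I = "UNIV \<odot> J \<odot> UNIV"
  have "r * a \<in> ?I \<and> a * r \<in> ?I" if "a \<in> ?I" for r a
    using that
  proof (induction rule: set_prod_induct)
    case zero
    then show ?case by (simp add: set_prod_zero)
  next
    case (add a b)
    then show ?case by (simp add: distrib_left distrib_right set_prod_add)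
  next
    case (mult u v)
    \<comment> \<open>As \<open>u\<close> is itself a sum of products s j, absorbing
      \<open>r\<close> on the left takes a second, inner induction.\<close>
    from \<open>u \<in> UNIV \<odot> J\<close> have "r * u \<in> UNIV \<odot> J"
    proof (induction rule: set_prod_induct)
      case (mult s j)
      then show ?case
        using set_prod_mult[of "r * s" UNIV j J] by (simp add: mult.assoc)
    qed (simp_all add: set_prod_zero set_prod_add distrib_left)
    then show ?case
      using mult set_prod_mult[of "r * u" "UNIV \<odot> J" v UNIV]
        set_prod_mult[of u "UNIV \<odot> J" "v * r" UNIV]
      by (simp add: mult.assoc)
  qed
  then show ?thesis
    by (simp add: ideal_of_def add_subgroup_set_prod add_subgroup_UNIV)
qed

section \<open>Components with respect to a direct sum\<close>

text \<open>The inverse of the summation map, so for a direct sum \<open>M\<close> it sends m in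
  \<open>M\<close> to the family of its components.\<close>

definition component :: "'i set \<Rightarrow> ('i \<Rightarrow> 'a::ab_group_add set) \<Rightarrow> 'a \<Rightarrow> 'i \<Rightarrow> 'a" where
  "component I N = the_inv_into (direct_sum_families I N) (\<lambda>f. \<Sum>i | f i \<noteq> 0. f i)"

context
  fixes I :: "'i set" and N :: "'i \<Rightarrow> 'a::ab_group_add set" and M
  assumes ds: "is_direct_sum I N M"
begin

lemma direct_sum_add_subgroup: "i \<in> I \<Longrightarrow> add_subgroup (N i)"
  using ds by (simp add: is_direct_sum_def)

lemma component_eqI:
  assumes "f \<in> direct_sum_families I N" "m = (\<Sum>i | f i \<noteq> 0. f i)"
  shows "component I N m = f"
  unfolding component_def assms(2)
  by (rule the_inv_into_f_f) (use ds assms(1) in \<open>auto simp: is_direct_sum_def bij_betw_def\<close>)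

lemma component_families: "m \<in> M \<Longrightarrow> component I N m \<in> direct_sum_families I N"
  and sum_component: "m \<in> M \<Longrightarrow> (\<Sum>i | component I N m i \<noteq> 0. component I N m i) = m"
proof -
  assume "m \<in> M"
  then obtain f where f: "f \<in> direct_sum_families I N" "m = (\<Sum>i | f i \<noteq> 0. f i)"
    using ds by (auto simp: is_direct_sum_def bij_betw_def)
  with component_eqI show "component I N m \<in> direct_sum_families I N"
    "(\<Sum>i | component I N m i \<noteq> 0. component I N m i) = m"
    by simp_all
qed

lemma component_mem: "m \<in> M \<Longrightarrow> i \<in> I \<Longrightarrow> component I N m i \<in> N i"
  and component_outside: "m \<in> M \<Longrightarrow> i \<notin> I \<Longrightarrow> component I N m i = 0"
  and finite_component: "m \<in> M \<Longrightarrow> finite {i. component I N m i \<noteq> 0}"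
  by (use component_families[of m] in \<open>simp_all add: direct_sum_families_def\<close>)

text \<open>The pointwise sum of the two families is again admissible and sums to a + b, so
  uniqueness identifies it.\<close>

lemma component_add:
  assumes "a \<in> M" "b \<in> M"
  shows "component I N (a + b) i = component I N a i + component I N b i"
proof -
  let ?f = "component I N a" and ?g = "component I N b"
  let ?A = "{i. ?f i \<noteq> 0} \<union> {i. ?g i \<noteq> 0}"
  have fin: "finite ?A"
    using assms by (simp add: finite_component)
  have "(\<lambda>i. ?f i + ?g i) \<in> direct_sum_families I N"
    unfolding direct_sum_families_def
    using assms by (auto intro!: add_subgroup_add direct_sum_add_subgroup component_mem
        finite_subset[OF _ fin] simp: component_outside)
  moreover have "a + b = (\<Sum>i | ?f i + ?g i \<noteq> 0. ?f i + ?g i)"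
  proof -
    \<comment> \<open>The three supports may differ, also through cancellation; all sums are
      extended by zeros to the common finite set \<open>?A\<close>.\<close>
    have "(\<Sum>i | ?f i + ?g i \<noteq> 0. ?f i + ?g i) = (\<Sum>i\<in>?A. ?f i + ?g i)"
      by (rule sum.mono_neutral_left) (use fin in auto)
    also have "\<dots> = sum ?f ?A + sum ?g ?A"
      by (rule sum.distrib)
    also have "sum ?f ?A = (\<Sum>i | ?f i \<noteq> 0. ?f i)"
      by (rule sum.mono_neutral_right) (use fin in auto)
    also have "sum ?g ?A = (\<Sum>i | ?g i \<noteq> 0. ?g i)"
      by (rule sum.mono_neutral_right) (use fin in auto)
    finally show ?thesis
      using assms by (simp add: sum_component)
  qed
  ultimately show ?thesis
    by (rule fun_cong[OF component_eqI])
qed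

lemma component_single:
  assumes "i \<in> I" "a \<in> N i"
  shows "component I N a k = (if k = i then a else 0)"
proof -
  \<comment> \<open>The family concentrated at \<open>i\<close> has empty support when
    \<open>a\<close> is 0.\<close>
  have "{k. (if k = i then a else 0) \<noteq> 0} = (if a = 0 then {} else {i})"
    by auto
  then have "(\<lambda>k. if k = i then a else 0) \<in> direct_sum_families I N"
    "a = (\<Sum>k | (if k = i then a else 0) \<noteq> 0. if k = i then a else 0)"
    unfolding direct_sum_families_def
    using assms by (auto intro: add_subgroup_zero direct_sum_add_subgroup)
  then show ?thesis
    by (rule fun_cong[OF component_eqI])
qed

text \<open>Uniqueness of decompositions is inherited from \<open>M\<close>; closure of
  \<open>K\<close> under components gives their existence inside \<open>K\<close>.\<close>

lemma is_direct_sum_Int: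
  assumes K: "K \<subseteq> M" "add_subgroup K"
    and comp: "\<And>a i. a \<in> K \<Longrightarrow> i \<in> I \<Longrightarrow> component I N a i \<in> K"
  shows "is_direct_sum I (\<lambda>i. K \<inter> N i) K"
proof -
  let ?s = "\<lambda>f. \<Sum>i | f i \<noteq> 0. f i"
  have sub: "direct_sum_families I (\<lambda>i. K \<inter> N i) \<subseteq> direct_sum_families I N"
    by (auto simp: direct_sum_families_def)
  have "inj_on ?s (direct_sum_families I (\<lambda>i. K \<inter> N i))"
    using ds sub by (auto simp: is_direct_sum_def bij_betw_def intro: inj_on_subset)
  moreover have "?s ` direct_sum_families I (\<lambda>i. K \<inter> N i) = K"
  proof (intro equalityI subsetI)
    fix a assume "a \<in> ?s ` direct_sum_families I (\<lambda>i. K \<inter> N i)"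
    then obtain f where f: "f \<in> direct_sum_families I (\<lambda>i. K \<inter> N i)" "a = ?s f"
      by blast
    have "f i \<in> K" for i
      using f(1) add_subgroup_zero[OF K(2)] by (cases "i \<in> I") (auto simp: direct_sum_families_def)
    then show "a \<in> K"
      unfolding f(2) by (intro add_subgroup_sum K(2))
  next
    fix a assume a: "a \<in> K"
    with K(1) have "a \<in> M" by blast
    then have "component I N a \<in> direct_sum_families I (\<lambda>i. K \<inter> N i)" "a = ?s (component I N a)"
      using comp a component_families[of a] by (auto simp: direct_sum_families_def sum_component)
    then show "a \<in> ?s ` direct_sum_families I (\<lambda>i. K \<inter> N i)"
      by blast
  qed
  ultimately show ?thesis
    using K(2) by (simp add: is_direct_sum_def bij_betw_def add_subgroup_Int direct_sum_add_subgroup)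
qed

text \<open>Serves to reduce additive statements to homogeneous elements.\<close>

lemma direct_sum_induct:
  assumes "m \<in> M"
    and "P 0"
    and "\<And>a b. P a \<Longrightarrow> P b \<Longrightarrow> P (a + b)"
    and "\<And>i a. i \<in> I \<Longrightarrow> a \<in> N i \<Longrightarrow> P a"
  shows "P m"
proof -
  have "P (component I N m i)" for i
    using component_mem[OF assms(1)] component_outside[OF assms(1)] assms(2,4)
    by (cases "i \<in> I") auto
  then have "P (sum (component I N m) F)" for F
    by (induction F rule: infinite_finite_induct) (simp_all add: assms(2,3))
  from this[of "{i. component I N m i \<noteq> 0}"] show ?thesis
    by (simp add: sum_component[OF assms(1)])
qed

end

section \<open>Graded ideals and invariant ideals\<close>

locale nearly_epsilon_strongly_graded_ring = group G
  for G :: "('g, 'm) monoid_scheme" (structure) and S :: "'g \<Rightarrow> 'a::ring set" +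
  assumes nearly_eps: "nearly_epsilon_strongly_graded G S"
begin

lemma direct_sum: "is_direct_sum (carrier G) S UNIV"
  using nearly_eps by (simp add: nearly_epsilon_strongly_graded_def graded_ring_def)

lemma degree_mult:
  "x \<in> carrier G \<Longrightarrow> y \<in> carrier G \<Longrightarrow> s \<in> S x \<Longrightarrow> t \<in> S y \<Longrightarrow> s * t \<in> S (x \<otimes> y)"
  using nearly_eps set_prod_mult[of s "S x" t "S y"]
  by (auto simp: nearly_epsilon_strongly_graded_def graded_ring_def)

lemma local_units:
  assumes "x \<in> carrier G" "s \<in> S x"
  obtains \<epsilon> \<epsilon>' where "\<epsilon> \<in> S x \<odot> S (inv x)" "\<epsilon> * s = s" "s * \<epsilon>' = s"
  using nearly_eps assms unfolding nearly_epsilon_strongly_graded_def by metis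

lemma add_subgroup_degree: "x \<in> carrier G \<Longrightarrow> add_subgroup (S x)"
  by (rule direct_sum_add_subgroup[OF direct_sum])

section \<open>Intersecting graded ideals with the neutral component\<close>

text \<open>Invariance is a degree count, as inv x, \<one> and x multiply to \<one>, while the ideal
  property keeps the product in \<open>I\<close>.\<close>

lemma invariant_ideal_Int:
  assumes "graded_ideal G S I"
  shows "invariant_ideal G S (I \<inter> S \<one>)"
proof -
  have I: "add_subgroup I" "\<And>r a. a \<in> I \<Longrightarrow> r * a \<in> I" "\<And>r a. a \<in> I \<Longrightarrow> a * r \<in> I"
    using assms by (auto simp: graded_ideal_def ideal_of_def)
  have one: "s * t \<in> S \<one>" if "s \<in> S \<one>" "t \<in> S \<one>" for s t
    using degree_mult[of \<one> \<one> s t] that by simp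
  have "S (inv x) \<odot> (I \<inter> S \<one>) \<odot> S x \<subseteq> I \<inter> S \<one>" if x: "x \<in> carrier G" for x
  proof (rule set_prod_subset)
    show "add_subgroup (I \<inter> S \<one>)"
      by (simp add: add_subgroup_Int I(1) add_subgroup_degree)
    have "S (inv x) \<odot> (I \<inter> S \<one>) \<subseteq> I \<inter> S (inv x)"
      using x degree_mult[of "inv x" \<one>]
      by (intro set_prod_subset) (auto intro: add_subgroup_Int I add_subgroup_degree)
    then show "u * v \<in> I \<inter> S \<one>" if "u \<in> S (inv x) \<odot> (I \<inter> S \<one>)" "v \<in> S x" for u v
      using x that degree_mult[of "inv x" x u v] I(3) by auto
  qed
  then show ?thesis
    unfolding invariant_ideal_def ideal_of_def
    using I one by (auto intro: add_subgroup_Int add_subgroup_degree)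
qed

lemma graded_ideal_eq:
  assumes "graded_ideal G S I"
  shows "UNIV \<odot> (I \<inter> S \<one>) \<odot> UNIV = I"
proof
  have I: "add_subgroup I" "\<And>r a. a \<in> I \<Longrightarrow> r * a \<in> I" "\<And>r a. a \<in> I \<Longrightarrow> a * r \<in> I"
    and ds: "is_direct_sum (carrier G) (\<lambda>x. I \<inter> S x) I"
    using assms by (auto simp: graded_ideal_def ideal_of_def)
  have "UNIV \<odot> (I \<inter> S \<one>) \<subseteq> I"
    by (rule set_prod_subset) (use I in auto)
  then show "UNIV \<odot> (I \<inter> S \<one>) \<odot> UNIV \<subseteq> I"
    by (intro set_prod_subset) (use I in auto)
  show "I \<subseteq> UNIV \<odot> (I \<inter> S \<one>) \<odot> UNIV"
  proof
    fix a assume "a \<in> I"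
    with ds show "a \<in> UNIV \<odot> (I \<inter> S \<one>) \<odot> UNIV"
    proof (rule direct_sum_induct)
      fix x a assume x: "x \<in> carrier G" and a: "a \<in> I \<inter> S x"
      then obtain \<epsilon> \<epsilon>' where eps: "\<epsilon> \<in> S x \<odot> S (inv x)" "\<epsilon> * a = a" "a * \<epsilon>' = a"
        using local_units[of x a] by blast
      \<comment> \<open>Expanding \<epsilon> into products u v moves v next to \<open>a\<close>: v a
        has degree \<one> and stays in \<open>I\<close>.\<close>
      from eps(1) have "\<epsilon> * a \<in> UNIV \<odot> (I \<inter> S \<one>)"
      proof (induction rule: set_prod_induct)
        case (mult u v)
        have "v * a \<in> I \<inter> S \<one>"
          using degree_mult[of "inv x" x v a] I(2) mult x a by simp
        then show ?case
          using set_prod_mult[of u UNIV "v * a"] by (simp add: mult.assoc)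
      qed (simp_all add: set_prod_zero set_prod_add distrib_right)
      \<comment> \<open>The ring may lack an identity, so the right local unit supplies the outer
        right factor.\<close>
      then show "a \<in> UNIV \<odot> (I \<inter> S \<one>) \<odot> UNIV"
        using set_prod_mult[of a "UNIV \<odot> (I \<inter> S \<one>)" \<epsilon>' UNIV] eps by simp
    qed (simp_all add: set_prod_zero set_prod_add)
  qed
qed

section \<open>Ideals generated by invariant ideals\<close>

text \<open>The first claim makes SJS graded and the second recovers \<open>J\<close> from it. Both
  are additive, so one reduction to homogeneous products r j s proves them together.\<close>

lemma component_set_prod:
  assumes J: "invariant_ideal G S J" and z: "z \<in> carrier G" and a: "a \<in> UNIV \<odot> J \<odot> UNIV"
  shows "component (carrier G) S a z \<in> UNIV \<odot> J \<odot> UNIV \<and>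
    (z = \<one> \<longrightarrow> component (carrier G) S a z \<in> J)"
proof -
  define P where "P a \<longleftrightarrow> component (carrier G) S a z \<in> UNIV \<odot> J \<odot> UNIV \<and>
    (z = \<one> \<longrightarrow> component (carrier G) S a z \<in> J)" for a
  have J': "J \<subseteq> S \<one>" "add_subgroup J"
    and inv: "\<And>x. x \<in> carrier G \<Longrightarrow> S (inv x) \<odot> J \<odot> S x \<subseteq> J"
    using J by (auto simp: invariant_ideal_def ideal_of_def)
  \<comment> \<open>Zero is treated as a homogeneous element of degree \<open>z\<close>.\<close>
  have component_zero: "component (carrier G) S 0 z = 0"
    using component_single[OF direct_sum z, of 0 z] add_subgroup_zero[OF add_subgroup_degree[OF z]]
    by simp
  have zero: "P 0"
    unfolding P_def component_zero by (simp add: set_prod_zero add_subgroup_zero[OF J'(2)])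
  have add: "P (a + b)" if "P a" "P b" for a b
    using that by (auto simp: P_def component_add[OF direct_sum] intro: set_prod_add
        add_subgroup_add[OF J'(2)])
  have homogeneous: "P (r * j * s)"
    if xy: "x \<in> carrier G" "y \<in> carrier G" and rs: "r \<in> S x" "s \<in> S y" and j: "j \<in> J" for x y r j s
  proof -
    have "r * j \<in> S (x \<otimes> \<one>)"
      by (rule degree_mult) (use that J' in auto)
    then have "r * j * s \<in> S (x \<otimes> y)"
      using xy rs by (simp add: degree_mult)
    then have comp: "component (carrier G) S (r * j * s) z = (if z = x \<otimes> y then r * j * s else 0)"
      using xy by (intro component_single[OF direct_sum]) auto
    have "r * j * s \<in> J" if "x \<otimes> y = \<one>"
    proof -
      \<comment> \<open>This is where invariance enters: r j s now has the form governed by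
        \<open>inv\<close> at \<open>y\<close>.\<close>
      have "x = inv y"
        using that xy by (simp add: inv_equality)
      then show ?thesis
        using inv[OF xy(2)] rs j by (blast intro: set_prod_mult)
    qed
    moreover have "r * j * s \<in> UNIV \<odot> J \<odot> UNIV"
      using j by (intro set_prod_mult) auto
    ultimately show ?thesis
      using add_subgroup_zero[OF J'(2)] unfolding P_def comp by (simp add: set_prod_zero)
  qed
  \<comment> \<open>Homogeneity is dropped one factor at a time: first for \<open>r\<close> with
    \<open>s\<close> homogeneous, then for \<open>s\<close>.\<close>
  have left: "P (r * j * s)" if "y \<in> carrier G" "s \<in> S y" "j \<in> J" for r j s y
  proof (rule direct_sum_induct[OF direct_sum, where m = r and P = "\<lambda>r. P (r * j * s)"])
    show "P (r * j * s)" if "x \<in> carrier G" "r \<in> S x" for x r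
      using homogeneous that \<open>y \<in> carrier G\<close> \<open>s \<in> S y\<close> \<open>j \<in> J\<close> by blast
  qed (simp_all add: distrib_right zero add)
  have both: "P (r * j * s)" if "j \<in> J" for r j s
  proof (rule direct_sum_induct[OF direct_sum, where m = s and P = "\<lambda>s. P (r * j * s)"])
    show "P (r * j * s)" if "y \<in> carrier G" "s \<in> S y" for y s
      using left that \<open>j \<in> J\<close> by blast
  qed (simp_all add: distrib_left zero add)
  from a have "P a"
  proof (induction rule: set_prod_induct)
    case (mult u s)
    from mult(1) show ?case
      by (induction rule: set_prod_induct) (auto simp: distrib_right zero intro: add both)
  qed (auto intro: zero add)
  then show ?thesis
    by (simp add: P_def)
qed

lemma graded_ideal_set_prod:
  assumes "invariant_ideal G S J"
  shows "graded_ideal G S (UNIV \<odot> J \<odot> UNIV)"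
  unfolding graded_ideal_def
proof
  show "is_direct_sum (carrier G) (\<lambda>x. (UNIV \<odot> J \<odot> UNIV) \<inter> S x) (UNIV \<odot> J \<odot> UNIV)"
    by (rule is_direct_sum_Int[OF direct_sum])
       (simp_all add: add_subgroup_set_prod add_subgroup_UNIV component_set_prod[OF assms])
qed (rule ideal_of_UNIV_set_prod)

text \<open>An element of degree \<one> equals its own \<one>-component, which lies in
  \<open>J\<close>. Conversely, local units write j as (\<epsilon> j) \<epsilon>'.\<close>

lemma invariant_ideal_eq:
  assumes "invariant_ideal G S J"
  shows "(UNIV \<odot> J \<odot> UNIV) \<inter> S \<one> = J"
proof (intro equalityI subsetI)
  fix a assume a: "a \<in> (UNIV \<odot> J \<odot> UNIV) \<inter> S \<one>"
  then have "component (carrier G) S a \<one> = a"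
    by (simp add: component_single[OF direct_sum one_closed])
  then show "a \<in> J"
    using component_set_prod[OF assms one_closed, of a] a by simp
next
  fix j assume j: "j \<in> J"
  then have "j \<in> S \<one>"
    using assms by (auto simp: invariant_ideal_def ideal_of_def)
  moreover from this obtain \<epsilon> \<epsilon>' where "\<epsilon> * j = j" "j * \<epsilon>' = j"
    by (rule local_units[OF one_closed])
  then have "j \<in> UNIV \<odot> J \<odot> UNIV"
    using set_prod_mult[of "\<epsilon> * j" "UNIV \<odot> J" \<epsilon>' UNIV] set_prod_mult[of \<epsilon> UNIV j J] j by simp
  ultimately show "j \<in> (UNIV \<odot> J \<odot> UNIV) \<inter> S \<one>"
    by simp
qed

end

theorem theorem4p7:
  fixes G :: "('g, 'm) monoid_scheme"
    and S :: "'g \<Rightarrow> 'a::ring set"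
  assumes "group G"
    and "(UNIV :: 'a set) \<noteq> {0}"
    and "nearly_epsilon_strongly_graded G S"
  shows "bij_betw (\<lambda>I. I \<inter> S \<one>\<^bsub>G\<^esub>) {I. graded_ideal G S I} {J. invariant_ideal G S J}
    \<and> (\<forall>J\<in>{J. invariant_ideal G S J}.
          the_inv_into {I. graded_ideal G S I} (\<lambda>I. I \<inter> S \<one>\<^bsub>G\<^esub>) J = UNIV \<odot> J \<odot> UNIV)"
proof -
  interpret nearly_epsilon_strongly_graded_ring G S
    using assms by (simp add: nearly_epsilon_strongly_graded_ring_def
        nearly_epsilon_strongly_graded_ring_axioms_def)
  have bij: "bij_betw (\<lambda>I. I \<inter> S \<one>\<^bsub>G\<^esub>) {I. graded_ideal G S I} {J. invariant_ideal G S J}"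
    by (rule bij_betw_byWitness[where f' = "\<lambda>J. UNIV \<odot> J \<odot> UNIV"])
       (auto simp: graded_ideal_eq invariant_ideal_eq intro: invariant_ideal_Int
          graded_ideal_set_prod)
  moreover have "the_inv_into {I. graded_ideal G S I} (\<lambda>I. I \<inter> S \<one>\<^bsub>G\<^esub>) J = UNIV \<odot> J \<odot> UNIV"
    if "invariant_ideal G S J" for J
    \<comment> \<open>By injectivity the inverse value is any graded ideal that restricts to
      \<open>J\<close>, and SJS is one.\<close>
    using bij that
    by (intro the_inv_into_f_eq) (simp_all add: bij_betw_def invariant_ideal_eq graded_ideal_set_prod)
  ultimately show ?thesis
    by simp
qed

end
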